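(* Let $r\ge 1$ be an integer, let $g(t)\in\mathbb{R}[[t]]$ and let $\mathbf{x}=(x_i)_{i\ge 1}$ be a sequence of real numbers. Define $(\mathcal{A}_n(\mathbf{x}))_{n\ge 0}$ by $$\sum_{n\ge 0}\mathcal{A}_n(\mathbf{x})t^n=g(t)\exp\Big(\sum_{j\ge 1}x_j\frac{t^j}{j}\Big).$$ Assume that $g(t)$ is a PF$_r$ function. If there exists a nonnegative sequence $(\lambda_i)_{i\ge 1}$ such that $x_n=\sum_{i\ge 1}\lambda_i^n$ for all $n\ge 1$, then the Toeplitz matrix $[\mathcal{A}_{i-j}(\mathbf{x})]_{i,j\ge 0}$ is TP$_r$.
   Context: A real matrix is TP$_r$ if all its minors of order $k\le r$ are nonnegative. A formal power series $\sum_{n\ge 0}a_nt^n\in\mathbb{R}[[t]]$ is called a PF$_r$ function if its infinite Toeplitz matrix $[a_{i-j}]_{i,j\ge 0}$ is TP$_r$. In Toeplitz matrices, entries with negative index are $0$. *)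

theory Defs
  imports Complex_Main
    "HOL-Computational_Algebra.Formal_Power_Series"
    "Jordan_Normal_Form.Determinant"
begin

text \<open>Rows and columns of an infinite matrix are indexed by the natural numbers; a minor of
  order \<open>k\<close> is given by increasing row indices \<open>I 0 < \<dots> < I (k - 1)\<close> and increasing column indices
  \<open>J 0 < \<dots> < J (k - 1)\<close>.\<close>

definition matrix_minor :: "(nat \<Rightarrow> nat \<Rightarrow> real) \<Rightarrow> nat \<Rightarrow> (nat \<Rightarrow> nat) \<Rightarrow> (nat \<Rightarrow> nat) \<Rightarrow> real" where
  "matrix_minor M k I J = det (mat k k (\<lambda>(p, q). M (I p) (J q)))"

definition totally_positive :: "nat \<Rightarrow> (nat \<Rightarrow> nat \<Rightarrow> real) \<Rightarrow> bool" where
  "totally_positive r M \<longleftrightarrow>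
    (\<forall>k I J. 1 \<le> k \<and> k \<le> r \<and> strict_mono_on {..<k} I \<and> strict_mono_on {..<k} J
       \<longrightarrow> 0 \<le> matrix_minor M k I J)"

definition toeplitz :: "(nat \<Rightarrow> real) \<Rightarrow> nat \<Rightarrow> nat \<Rightarrow> real" where
  "toeplitz a i j = (if j \<le> i then a (i - j) else 0)"

definition PF_function :: "nat \<Rightarrow> real fps \<Rightarrow> bool" where
  "PF_function r g \<longleftrightarrow> totally_positive r (toeplitz (fps_nth g))"

text \<open>\<open>fps_exp 1\<close> is the series \<open>\<Sum> t^n / n!\<close>, so composing with it on the left is the formal
  exponential of a series with zero constant term. The value \<open>x 0\<close> is not used.\<close>

definition A_seq :: "real fps \<Rightarrow> (nat \<Rightarrow> real) \<Rightarrow> nat \<Rightarrow> real" where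
  "A_seq g x =
    fps_nth (g * fps_compose (fps_exp 1) (Abs_fps (\<lambda>j. if j = 0 then 0 else x j / real j)))"

end

theory Submission
  imports Defs "HOL-Library.FuncSet"
begin

text \<open>
  If only finitely many \<open>\<lambda>\<^sub>i\<close> are nonzero, then
  \<open>exp (\<Sum>\<^sub>j x\<^sub>j t\<^sup>j / j) = \<Prod>\<^sub>i 1 / (1 - \<lambda>\<^sub>i t)\<close>, so the series in question arises from \<open>g\<close> by finitely
  many divisions by factors \<open>1 - \<lambda> t\<close> with \<open>\<lambda> \<ge> 0\<close>. If \<open>h\<close> is the quotient of \<open>f\<close> by such a factor,
  then \<open>h\<^sub>n\<^sub>+\<^sub>1 = f\<^sub>n\<^sub>+\<^sub>1 + \<lambda> h\<^sub>n\<close>, and the rows of the two Toeplitz matrices obey the same recursion.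
  Total positivity survives it (\<open>totally_positive_row_recursion\<close>): subtracting from each
  selected row of a minor of the new matrix the right multiple of the preceding selected row leaves
  a nonnegative combination of the old rows that come after the preceding selected index and
  no later than the row's own. The ranges for different selected rows are disjoint and increasing, so multilinearity of the determinant
  writes the new minor as a nonnegative combination of old minors of the same order. This
  replaces the Cauchy--Binet formula, and it keeps the order of the minors fixed.

  In general, the truncations \<open>\<Sum>\<^sub>i\<^sub><\<^sub>N \<lambda>\<^sub>i\<^sup>n\<close> converge to \<open>x\<^sub>n\<close>. Each coefficient of the exponential series
  is a polynomial in finitely many \<open>x\<^sub>n\<close>, so the Toeplitz matrices converge entrywise, and
  nonnegativity of a minor passes to the limit.
\<close>

section \<open>Determinants whose rows are combinations of rows\<close>

lemma det_row_combinations: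
  fixes M :: "'a \<Rightarrow> nat \<Rightarrow> 'b::comm_ring_1"
  assumes "\<And>p. p < k \<Longrightarrow> finite (S p)"
  shows "det (mat k k (\<lambda>(p, q). \<Sum>s\<in>S p. c p s * M s q)) =
    (\<Sum>I\<in>Pi\<^sub>E {0..<k} S. (\<Prod>p=0..<k. c p (I p)) * det (mat k k (\<lambda>(p, q). M (I p) q)))"
proof -
  have "det (mat k k (\<lambda>(p, q). \<Sum>s\<in>S p. c p s * M s q)) =
      (\<Sum>\<pi> | \<pi> permutes {0..<k}. signof \<pi> * (\<Prod>p=0..<k. \<Sum>s\<in>S p. c p s * M s (\<pi> p)))"
    by (subst det_def'[of _ k]) (auto intro!: sum.cong arg_cong2[where f="(*)"] prod.cong)
  also have "\<dots> = (\<Sum>\<pi> | \<pi> permutes {0..<k}. \<Sum>I\<in>Pi\<^sub>E {0..<k} S.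
      signof \<pi> * (\<Prod>p=0..<k. c p (I p) * M (I p) (\<pi> p)))"
    using assms by (subst prod_sum_PiE) (auto simp: sum_distrib_left)
  also have "\<dots> = (\<Sum>I\<in>Pi\<^sub>E {0..<k} S. \<Sum>\<pi> | \<pi> permutes {0..<k}.
      signof \<pi> * (\<Prod>p=0..<k. c p (I p) * M (I p) (\<pi> p)))"
    by (rule sum.swap)
  also have "\<dots> = (\<Sum>I\<in>Pi\<^sub>E {0..<k} S. (\<Prod>p=0..<k. c p (I p)) *
      (\<Sum>\<pi> | \<pi> permutes {0..<k}. signof \<pi> * (\<Prod>p=0..<k. M (I p) (\<pi> p))))"
    by (simp add: sum_distrib_left prod.distrib algebra_simps)
  also have "\<dots> = (\<Sum>I\<in>Pi\<^sub>E {0..<k} S. (\<Prod>p=0..<k. c p (I p)) *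
      det (mat k k (\<lambda>(p, q). M (I p) q)))"
    by (subst det_def'[of _ k]) (auto intro!: sum.cong arg_cong2[where f="(*)"] prod.cong)
  finally show ?thesis .
qed

text \<open>The row operations act simultaneously on the original rows, so they amount to
  multiplication from the left by a unipotent lower bidiagonal matrix.\<close>

lemma det_subtract_preceding_rows:
  fixes R :: "nat \<Rightarrow> nat \<Rightarrow> 'a::idom"
  shows "det (mat k k (\<lambda>(p, q). if p = 0 then R p q else R p q - c p * R (p - 1) q)) =
    det (mat k k (\<lambda>(p, q). R p q))"
proof -
  define L where
    "L = mat k k (\<lambda>(p, j). if j = p then 1 else if Suc j = p then - c p else 0)"
  have L: "L \<in> carrier_mat k k" by (simp add: L_def)
  have "mat k k (\<lambda>(p, q). if p = 0 then R p q else R p q - c p * R (p - 1) q) =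
      L * mat k k (\<lambda>(p, q). R p q)" (is "?A = L * ?R")
  proof (rule eq_matI)
    fix p q assume "p < dim_row (L * ?R)" "q < dim_col (L * ?R)"
    then have pq: "p < k" "q < k" by (simp_all add: L_def)
    have "(L * ?R) $$ (p, q) =
        (\<Sum>j=0..<k. (if j = p then R j q else 0) + (if Suc j = p then - c p * R j q else 0))"
      using pq by (auto simp: L_def scalar_prod_def intro!: sum.cong)
    also have "\<dots> = R p q + (\<Sum>j=0..<k. if Suc j = p then - c p * R j q else 0)"
      using pq by (simp add: sum.distrib)
    also have "(\<Sum>j=0..<k. if Suc j = p then - c p * R j q else 0) =
        (if p = 0 then 0 else - c p * R (p - 1) q)"
      using pq by (cases p) auto
    finally show "?A $$ (p, q) = (L * ?R) $$ (p, q)"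
      using pq by simp
  qed (simp_all add: L_def)
  moreover have "det L = 1"
    using L by (subst det_lower_triangular[of k]) (auto simp: L_def prod_list_diag_prod)
  ultimately show ?thesis
    using L by (simp add: det_mult[of _ k])
qed

section \<open>Operations that preserve total positivity\<close>

lemma row_recursion_segment:
  fixes M M' :: "nat \<Rightarrow> nat \<Rightarrow> 'a::comm_ring_1"
  assumes "\<And>i j. M' (Suc i) j = M (Suc i) j + l * M' i j" and "a \<le> b"
  shows "M' b j - l ^ (b - a) * M' a j = (\<Sum>s\<in>{a<..b}. l ^ (b - s) * M s j)"
  using \<open>a \<le> b\<close>
proof (induction b rule: dec_induct)
  case (step b)
  have "(\<Sum>s\<in>{a<..Suc b}. l ^ (Suc b - s) * M s j) =
      M (Suc b) j + (\<Sum>s\<in>{a<..b}. l * (l ^ (b - s) * M s j))"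
  proof -
    have "{a<..Suc b} = insert (Suc b) {a<..b}"
      using step.hyps by auto
    then show ?thesis
      by (auto simp: Suc_diff_le mult.assoc intro!: sum.cong)
  qed
  also have "\<dots> = M (Suc b) j + l * (M' b j - l ^ (b - a) * M' a j)"
    by (simp add: step.IH sum_distrib_left)
  finally show ?case
    using step.hyps by (simp add: assms(1) Suc_diff_le algebra_simps)
qed simp

lemma row_recursion_initial:
  fixes M M' :: "nat \<Rightarrow> nat \<Rightarrow> 'a::comm_ring_1"
  assumes "\<And>i j. M' (Suc i) j = M (Suc i) j + l * M' i j" and "\<And>j. M' 0 j = M 0 j"
  shows "M' b j = (\<Sum>s\<in>{..b}. l ^ (b - s) * M s j)"
proof (induction b)
  case (Suc b)
  have "(\<Sum>s\<in>{..b}. l ^ (Suc b - s) * M s j) = l * (\<Sum>s\<in>{..b}. l ^ (b - s) * M s j)"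
    by (simp add: sum_distrib_left Suc_diff_le mult.assoc)
  with Suc show ?case by (simp add: assms(1))
qed (simp add: assms(2))

text \<open>The row operation that clears the contribution of row \<open>I (p - 1)\<close> from row \<open>I p\<close> has
  the factor \<open>l ^ (I p - I (p - 1))\<close>; what is left only involves the old rows in
  \<open>{I (p - 1)<..I p}\<close>. A choice of one index from each of these consecutive intervals is
  strictly increasing, so the minors in the multilinear expansion are minors of \<open>M\<close>.\<close>

lemma totally_positive_row_recursion:
  assumes tp: "totally_positive r M" and "0 \<le> l"
    and rec: "\<And>i j. M' (Suc i) j = M (Suc i) j + l * M' i j"
    and init: "\<And>j. M' 0 j = M 0 j"
  shows "totally_positive r M'"
  unfolding totally_positive_def
proof (intro allI impI, elim conjE)
  fix k and I J :: "nat \<Rightarrow> nat"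
  assume k: "1 \<le> k" "k \<le> r" and I: "strict_mono_on {..<k} I" and J: "strict_mono_on {..<k} J"
  define S where "S p = (if p = 0 then {..I 0} else {I (p - 1)<..I p})" for p
  have "matrix_minor M' k I J = det (mat k k (\<lambda>(p, q). if p = 0 then M' (I p) (J q)
      else M' (I p) (J q) - l ^ (I p - I (p - 1)) * M' (I (p - 1)) (J q)))"
    unfolding matrix_minor_def
    by (rule det_subtract_preceding_rows[of k "\<lambda>p q. M' (I p) (J q)", symmetric])
  also have "mat k k (\<lambda>(p, q). if p = 0 then M' (I p) (J q)
      else M' (I p) (J q) - l ^ (I p - I (p - 1)) * M' (I (p - 1)) (J q)) =
      mat k k (\<lambda>(p, q). \<Sum>s\<in>S p. l ^ (I p - s) * M s (J q))"
  proof (rule cong_mat[OF refl refl], clarify)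
    fix p q assume p: "p < k" and "q < k"
    show "(if p = 0 then M' (I p) (J q)
        else M' (I p) (J q) - l ^ (I p - I (p - 1)) * M' (I (p - 1)) (J q)) =
        (\<Sum>s\<in>S p. l ^ (I p - s) * M s (J q))"
    proof (cases "p = 0")
      case True
      then show ?thesis using row_recursion_initial[of M' M l, OF rec init] by (simp add: S_def)
    next
      case False
      then have "I (p - 1) \<le> I p"
        using p by (intro less_imp_le strict_mono_onD[OF I]) auto
      from row_recursion_segment[of M' M l, OF rec this] False show ?thesis
        by (simp add: S_def)
    qed
  qed
  also have "det \<dots> = (\<Sum>K\<in>Pi\<^sub>E {0..<k} S. (\<Prod>p=0..<k. l ^ (I p - K p)) * matrix_minor M k K J)"
    unfolding matrix_minor_def
    by (rule det_row_combinations[of k S "\<lambda>p s. l ^ (I p - s)" "\<lambda>s q. M s (J q)"])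
      (simp add: S_def)
  also have "\<dots> \<ge> 0"
  proof (intro sum_nonneg mult_nonneg_nonneg prod_nonneg zero_le_power \<open>0 \<le> l\<close>)
    fix K assume K: "K \<in> Pi\<^sub>E {0..<k} S"
    have "strict_mono_on {..<k} K"
    proof (rule strict_mono_onI)
      fix p q assume pq: "p \<in> {..<k}" "q \<in> {..<k}" "p < q"
      have "K p \<in> S p" "K q \<in> S q" using K pq by auto
      then have "K p \<le> I p" "I (q - 1) < K q" using pq by (auto simp: S_def split: if_splits)
      moreover have "I p \<le> I (q - 1)"
        using pq by (cases "p = q - 1") (auto intro!: less_imp_le strict_mono_onD[OF I])
      ultimately show "K p < K q" by linarith
    qed
    with tp k J show "0 \<le> matrix_minor M k K J"
      unfolding totally_positive_def by blast
  qed
  finally show "0 \<le> matrix_minor M' k I J" .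
qed

lemma totally_positive_limit:
  assumes "\<And>N. totally_positive r (M N)" and "\<And>i j. (\<lambda>N. M N i j) \<longlonglongrightarrow> L i j"
  shows "totally_positive r L"
  unfolding totally_positive_def
proof (intro allI impI)
  fix k and I J :: "nat \<Rightarrow> nat"
  assume *: "1 \<le> k \<and> k \<le> r \<and> strict_mono_on {..<k} I \<and> strict_mono_on {..<k} J"
  have det: "matrix_minor A k I J =
      (\<Sum>\<pi> | \<pi> permutes {0..<k}. signof \<pi> * (\<Prod>p=0..<k. A (I p) (J (\<pi> p))))" for A
    unfolding matrix_minor_def
    by (subst det_def'[of _ k]) (auto intro!: sum.cong arg_cong2[where f="(*)"] prod.cong)
  have "(\<lambda>N. matrix_minor (M N) k I J) \<longlonglongrightarrow> matrix_minor L k I J"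
    unfolding det by (intro tendsto_intros assms(2))
  then show "0 \<le> matrix_minor L k I J"
    by (rule LIMSEQ_le_const) (use assms(1) * in \<open>auto simp: totally_positive_def\<close>)
qed

lemma fps_nth_mult_linear:
  fixes h :: "'a::comm_ring_1 fps"
  shows "fps_nth (h * (1 - fps_const l * fps_X)) n =
    fps_nth h n - (if n = 0 then 0 else l * fps_nth h (n - 1))"
proof -
  have "h * (1 - fps_const l * fps_X) = h - fps_const l * (h * fps_X)"
    by (simp add: algebra_simps)
  then show ?thesis by simp
qed

lemma PF_function_divide_linear:
  assumes "PF_function r f" and "0 \<le> l" and f: "h * (1 - fps_const l * fps_X) = f"
  shows "PF_function r h"
proof -
  have nth: "fps_nth f n = fps_nth h n - (if n = 0 then 0 else l * fps_nth h (n - 1))" for n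
    unfolding f[symmetric] by (rule fps_nth_mult_linear)
  show ?thesis
    unfolding PF_function_def
  proof (rule totally_positive_row_recursion[OF assms(1)[unfolded PF_function_def] assms(2)])
    fix i j
    show "toeplitz (fps_nth h) (Suc i) j =
        toeplitz (fps_nth f) (Suc i) j + l * toeplitz (fps_nth h) i j"
      by (cases "j \<le> i"; cases "j = Suc i") (auto simp: toeplitz_def nth Suc_diff_le)
    show "toeplitz (fps_nth h) 0 j = toeplitz (fps_nth f) 0 j"
      by (simp add: toeplitz_def nth)
  qed
qed

section \<open>Exponentials of power sum series\<close>

definition power_sum_series :: "(nat \<Rightarrow> real) \<Rightarrow> real fps" where
  "power_sum_series x = Abs_fps (\<lambda>j. if j = 0 then 0 else x j / real j)"

definition exp_power_sums :: "(nat \<Rightarrow> real) \<Rightarrow> real fps" where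
  "exp_power_sums x = fps_compose (fps_exp 1) (power_sum_series x)"

lemma A_seq_eq: "A_seq g x = fps_nth (g * exp_power_sums x)"
  by (simp add: A_seq_def exp_power_sums_def power_sum_series_def)

lemma exp_power_sums_nth_0 [simp]: "fps_nth (exp_power_sums x) 0 = 1"
  by (simp add: exp_power_sums_def)

lemma fps_deriv_power_sum_series:
  "fps_deriv (power_sum_series x) = Abs_fps (\<lambda>n. x (Suc n))"
  by (simp add: fps_eq_iff power_sum_series_def del: of_nat_Suc)

lemma fps_deriv_exp_power_sums:
  "fps_deriv (exp_power_sums x) = exp_power_sums x * Abs_fps (\<lambda>n. x (Suc n))"
  unfolding exp_power_sums_def fps_deriv_power_sum_series[symmetric]
  by (subst fps_compose_deriv) (simp_all add: power_sum_series_def)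

lemma fps_linear_ode_unique:
  fixes F G D :: "real fps"
  assumes "fps_deriv F = F * D" "fps_deriv G = G * D" "fps_nth F 0 = fps_nth G 0"
    and "fps_nth G 0 \<noteq> 0"
  shows "F = G"
proof -
  have inv: "G * inverse G = 1" using assms(4) by (rule inverse_mult_eq_1')
  have "fps_deriv (F * inverse G) = F * D * inverse G - F * (G * inverse G) * D * inverse G"
    using assms by (simp add: fps_inverse_deriv power2_eq_square algebra_simps)
  then have "fps_deriv (F * inverse G) = 0" by (simp add: inv)
  then have "F * inverse G = 1"
    using assms(3,4) unfolding fps_deriv_eq_0_iff by simp
  then have "F * (G * inverse G) = G" by (metis mult.commute mult.left_commute mult_1_right)
  then show ?thesis by (simp add: inv)
qed

text \<open>The new power sum contributes \<open>- ln (1 - l t)\<close> to the exponent. Both sides solve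
  \<open>F' = F \<cdot> D\<close> for the logarithmic derivative \<open>D = \<Sum>\<^sub>n x\<^sub>n\<^sub>+\<^sub>1 t\<^sup>n\<close> and have constant term 1,
  which avoids formal logarithms.\<close>

lemma exp_power_sums_add_power:
  "exp_power_sums (\<lambda>n. x n + l ^ n) * (1 - fps_const l * fps_X) = exp_power_sums x"
proof (rule fps_linear_ode_unique)
  let ?E = "exp_power_sums (\<lambda>n. x n + l ^ n)" and ?u = "1 - fps_const l * fps_X"
  let ?D = "Abs_fps (\<lambda>n. x (Suc n))" and ?P = "Abs_fps (\<lambda>n. l ^ Suc n)"
  have D: "Abs_fps (\<lambda>n. x (Suc n) + l ^ Suc n) = ?D + ?P"
    by (simp add: fps_eq_iff)
  have P: "?P * ?u = fps_const l"
  proof (rule fps_ext)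
    fix n show "fps_nth (?P * ?u) n = fps_nth (fps_const l) n"
      unfolding fps_nth_mult_linear by (cases n) auto
  qed
  have "fps_deriv ?E = ?E * (?D + ?P)"
    by (simp only: fps_deriv_exp_power_sums D)
  then have "fps_deriv (?E * ?u) = ?E * ?u * ?D + ?E * (?P * ?u) - ?E * fps_const l"
    by (simp add: algebra_simps del: power_Suc)
  then show "fps_deriv (?E * ?u) = ?E * ?u * ?D"
    unfolding P by simp
qed (simp_all add: fps_deriv_exp_power_sums)

lemma exp_power_sums_zero: "exp_power_sums (\<lambda>_. 0) = 1"
  by (rule fps_linear_ode_unique[where D = 0])
    (simp_all add: fps_deriv_exp_power_sums fps_zero_def[symmetric])

lemma PF_function_finite_power_sums:
  fixes l :: "nat \<Rightarrow> real"
  assumes "PF_function r g" and "\<And>i. 0 \<le> l i"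
  shows "PF_function r (g * exp_power_sums (\<lambda>n. \<Sum>i<N. l i ^ n))"
proof (induction N)
  case 0
  then show ?case using assms(1) by (simp add: exp_power_sums_zero)
next
  case (Suc N)
  show ?case
    by (rule PF_function_divide_linear[OF Suc assms(2)[of N]])
      (simp add: exp_power_sums_add_power mult.assoc)
qed

section \<open>Passage to infinitely many parameters\<close>

lemma fps_mult_nth_tendsto:
  fixes F G :: "nat \<Rightarrow> real fps"
  assumes "\<And>n. (\<lambda>N. fps_nth (F N) n) \<longlonglongrightarrow> fps_nth A n"
    and "\<And>n. (\<lambda>N. fps_nth (G N) n) \<longlonglongrightarrow> fps_nth B n"
  shows "(\<lambda>N. fps_nth (F N * G N) n) \<longlonglongrightarrow> fps_nth (A * B) n"
  unfolding fps_mult_nth by (intro tendsto_intros assms)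

lemma fps_power_nth_tendsto:
  fixes F :: "nat \<Rightarrow> real fps"
  assumes "\<And>n. (\<lambda>N. fps_nth (F N) n) \<longlonglongrightarrow> fps_nth A n"
  shows "(\<lambda>N. fps_nth (F N ^ k) n) \<longlonglongrightarrow> fps_nth (A ^ k) n"
proof (induction k arbitrary: n)
  case (Suc k)
  then show ?case unfolding power_Suc by (intro fps_mult_nth_tendsto assms)
qed simp

lemma exp_power_sums_nth_tendsto:
  assumes "\<And>j. 1 \<le> j \<Longrightarrow> (\<lambda>N. X N j) \<longlonglongrightarrow> x j"
  shows "(\<lambda>N. fps_nth (exp_power_sums (X N)) n) \<longlonglongrightarrow> fps_nth (exp_power_sums x) n"
proof -
  have "(\<lambda>N. fps_nth (power_sum_series (X N)) j) \<longlonglongrightarrow> fps_nth (power_sum_series x) j" for j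
    by (cases "j = 0") (auto simp: power_sum_series_def intro!: tendsto_intros assms)
  then show ?thesis
    unfolding exp_power_sums_def fps_compose_nth by (intro tendsto_intros fps_power_nth_tendsto)
qed

theorem theorem1p1:
  fixes r :: nat and g :: "real fps" and x :: "nat \<Rightarrow> real"
  assumes "r \<ge> 1"
    and "PF_function r g"
    and "\<exists>lam :: nat \<Rightarrow> real. (\<forall>i\<ge>1. 0 \<le> lam i) \<and>
           (\<forall>n\<ge>1. (\<lambda>i. lam (Suc i) ^ n) sums x n)"
  shows "totally_positive r (toeplitz (A_seq g x))"
proof -
  obtain lam :: "nat \<Rightarrow> real" where nonneg: "\<And>i. 1 \<le> i \<Longrightarrow> 0 \<le> lam i"
    and sums: "\<And>n. 1 \<le> n \<Longrightarrow> (\<lambda>i. lam (Suc i) ^ n) sums x n"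
    using assms(3) by blast
  define G where "G N = g * exp_power_sums (\<lambda>n. \<Sum>i<N. lam (Suc i) ^ n)" for N
  have coeff: "(\<lambda>N. fps_nth (G N) n) \<longlonglongrightarrow> A_seq g x n" for n
    unfolding G_def A_seq_eq
    using sums by (intro fps_mult_nth_tendsto exp_power_sums_nth_tendsto) (auto simp: sums_def)
  show ?thesis
  proof (rule totally_positive_limit)
    show "totally_positive r (toeplitz (fps_nth (G N)))" for N
      using PF_function_finite_power_sums[OF assms(2), of "\<lambda>i. lam (Suc i)"] nonneg
      by (simp add: G_def PF_function_def)
    show "(\<lambda>N. toeplitz (fps_nth (G N)) i j) \<longlonglongrightarrow> toeplitz (A_seq g x) i j" for i j
      by (simp add: toeplitz_def coeff)
  qed
qed

end
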